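(* For every integer $t \geq 2$ there exists a constant $c>0$ such that for every integer $n\geq t$ the following holds: if $G$ is a properly edge-coloured graph on $n$ vertices with at least $n e^{c\sqrt{\log n}}$ edges, then $G$ contains a rainbow subdivision of $K_t$ in which each edge of $K_t$ is replaced with a path of length at most $1300 \log^2 n$.
   Context: Graphs are finite and simple. An edge-colouring is proper if any two edges sharing a vertex have different colours. A subgraph of an edge-coloured graph is rainbow if no two of its edges have the same colour. A subdivision of $K_t$ is a graph obtained from $K_t$ by replacing its edges with internally vertex-disjoint paths (of length at least 1) joining the corresponding branch vertices and having no branch vertices in their interiors. The length of a path is its number of edges. $\log$ denotes the natural logarithm, and $\log^2 n=(\log n)^2$. *)

theory Defs
  imports Complex_Main "HOL-Library.Disjoint_Sets"
begin

definition simple_graph :: "'a set \<Rightarrow> 'a set set \<Rightarrow> bool" where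
  "simple_graph V E \<longleftrightarrow> finite V \<and> (\<forall>e\<in>E. e \<subseteq> V \<and> card e = 2)"

definition subgraph :: "'a set \<Rightarrow> 'a set set \<Rightarrow> 'a set \<Rightarrow> 'a set set \<Rightarrow> bool" where
  "subgraph V' E' V E \<longleftrightarrow> simple_graph V' E' \<and> V' \<subseteq> V \<and> E' \<subseteq> E"

definition complete_edges :: "'a set \<Rightarrow> 'a set set" where
  "complete_edges W = {e. e \<subseteq> W \<and> card e = 2}"

definition proper_edge_colouring :: "'a set set \<Rightarrow> ('a set \<Rightarrow> 'c) \<Rightarrow> bool" where
  "proper_edge_colouring E \<chi> \<longleftrightarrow>
     (\<forall>e\<in>E. \<forall>f\<in>E. e \<noteq> f \<and> e \<inter> f \<noteq> {} \<longrightarrow> \<chi> e \<noteq> \<chi> f)"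

definition rainbow :: "('a set \<Rightarrow> 'c) \<Rightarrow> 'a set set \<Rightarrow> bool" where
  "rainbow \<chi> E \<longleftrightarrow> inj_on \<chi> E"

text \<open>Paths are given by their vertex sequences; the underlying graph enters
  only through \<open>path_edges\<close>.\<close>

definition is_path :: "'a list \<Rightarrow> bool" where
  "is_path p \<longleftrightarrow> p \<noteq> [] \<and> distinct p"

definition path_edges :: "'a list \<Rightarrow> 'a set set" where
  "path_edges p = {{p ! i, p ! Suc i} | i. Suc i < length p}"

definition path_length :: "'a list \<Rightarrow> nat" where
  "path_length p = length p - 1"

definition path_interior :: "'a list \<Rightarrow> 'a set" where
  "path_interior p = set (butlast (tl p))"

text \<open>
  \<open>subdivision_via W F b P V E\<close>: the graph \<open>(V, E)\<close> arises from the graph \<open>(W, F)\<close> by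
  placing each vertex \<open>w\<close> at the branch vertex \<open>b w\<close> and replacing each edge \<open>e\<close> by the
  path \<open>P e\<close>.  Edges are unordered, so the direction in which \<open>P e\<close> lists its vertices
  is left open.  Every \<open>P e\<close> has length at least 1, since its two ends are distinct by
  injectivity of \<open>b\<close>.
\<close>

definition subdivision_via ::
  "'w set \<Rightarrow> 'w set set \<Rightarrow> ('w \<Rightarrow> 'a) \<Rightarrow> ('w set \<Rightarrow> 'a list) \<Rightarrow> 'a set \<Rightarrow> 'a set set \<Rightarrow> bool" where
  "subdivision_via W F b P V E \<longleftrightarrow>
     inj_on b W \<and>
     (\<forall>e\<in>F. is_path (P e) \<and> {hd (P e), last (P e)} = b ` e
            \<and> path_interior (P e) \<inter> b ` W = {}) \<and>
     disjoint_family_on (\<lambda>e. path_interior (P e)) F \<and>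
     V = b ` W \<union> (\<Union>e\<in>F. set (P e)) \<and>
     E = (\<Union>e\<in>F. path_edges (P e))"

end

theory Submission
  imports Defs
begin

text \<open>
  Choose a vertex set \<open>U\<close> that maximises \<open>e(U) / (|U| (1 + ln e(U)))\<close>, where \<open>e(U)\<close> counts
  ordered adjacent pairs.  The induced graph has large minimum degree, and every \<open>X\<close> carrying at
  most half of the degree sum sends a fraction \<open>\<delta> = \<Omega>(1 / log n)\<close> of its degrees to \<open>U - X\<close>.
  To join two vertices, grow a set of vertices reachable by rainbow paths: in each round a random
  sparse set of fresh colours is released, and the vertices joined to the current set by an edge
  of such a colour are added.  Sparseness keeps the used colours a negligible part of the
  colours at every vertex, so each round multiplies the degree sum by at least \<open>1 + \<delta> / 8\<close>,
  and \<open>O(log\<^sup>2 n)\<close> rounds capture more than half of it.  Growing from both ends with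
  disjoint colour sets yields two sets that meet.  This tolerates few forbidden vertices and
  colours, so the paths of the subdivision can be chosen greedily.  A polylogarithmic average
  degree is enough for this, and \<open>exp (c sqrt (log n))\<close> exceeds it.
\<close>

section \<open>Edge counts and expanding subgraphs\<close>


text \<open>Ordered pairs are counted, so without loops \<open>cut E X X\<close> is twice the number
  of edges inside \<open>X\<close>. For \<open>X \<subseteq> U\<close>, \<open>cut E X U\<close> is
  the degree sum of \<open>X\<close> in the graph induced on \<open>U\<close>; it replaces
  cardinality as the measure of a set.\<close>

definition cut :: "'a set set \<Rightarrow> 'a set \<Rightarrow> 'a set \<Rightarrow> real" where
  "cut E X Y = (\<Sum>x\<in>X. \<Sum>y\<in>Y. of_bool ({x, y} \<in> E))"

lemma cut_nonneg [simp]: "0 \<le> cut E X Y"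
  by (simp add: cut_def sum_nonneg)

lemma cut_commute: "cut E X Y = cut E Y X"
  unfolding cut_def by (subst sum.swap) (simp add: insert_commute)

lemma cut_Un_left:
  "finite X \<Longrightarrow> finite X' \<Longrightarrow> X \<inter> X' = {} \<Longrightarrow> cut E (X \<union> X') Y = cut E X Y + cut E X' Y"
  by (simp add: cut_def sum.union_disjoint)

lemma cut_mono_left: "finite X' \<Longrightarrow> X \<subseteq> X' \<Longrightarrow> cut E X Y \<le> cut E X' Y"
  unfolding cut_def by (rule sum_mono2) (auto simp: sum_nonneg)

lemma cut_mono_right: "finite Y' \<Longrightarrow> Y \<subseteq> Y' \<Longrightarrow> cut E X Y \<le> cut E X Y'"
  unfolding cut_def by (intro sum_mono sum_mono2) auto

lemma cut_le_card: "cut E X Y \<le> real (card X) * real (card Y)"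
proof -
  have "cut E X Y \<le> (\<Sum>x\<in>X. \<Sum>y\<in>Y. 1)"
    unfolding cut_def by (intro sum_mono) auto
  then show ?thesis by simp
qed

lemma cut_singleton: "finite Y \<Longrightarrow> cut E {x} Y = real (card {y\<in>Y. {x, y} \<in> E})"
  by (simp add: cut_def of_bool_def sum.If_cases Int_def)

lemma cut_eq_sum: "cut E X Y = (\<Sum>x\<in>X. cut E {x} Y)"
  by (simp add: cut_def)

lemma cut_ge_1:
  assumes "0 < cut E X Y"
  shows "1 \<le> cut E X Y"
proof -
  have "cut E X Y = of_nat (\<Sum>x\<in>X. \<Sum>y\<in>Y. of_bool ({x, y} \<in> E))"
    unfolding cut_def by (simp only: of_nat_sum of_nat_of_bool)
  with assms have "0 < (\<Sum>x\<in>X. \<Sum>y\<in>Y. of_bool ({x, y} \<in> E) :: nat)"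
    by (simp only: of_nat_0_less_iff)
  then show ?thesis unfolding \<open>cut E X Y = _\<close> by linarith
qed

lemma cut_split:
  assumes "finite U" "X \<subseteq> U"
  shows "cut E X U = cut E X X + cut E X (U - X)"
    and "cut E U U = cut E X X + 2 * cut E X (U - X) + cut E (U - X) (U - X)"
proof -
  have U: "U = X \<union> (U - X)" and fin: "finite X" "finite (U - X)"
    using assms finite_subset by auto
  have l: "cut E U Y = cut E X Y + cut E (U - X) Y" for Y
    by (subst (1) U, subst cut_Un_left) (use fin in auto)
  have r: "cut E Y U = cut E Y X + cut E Y (U - X)" for Y
    using l[of Y] by (simp add: cut_commute)
  show "cut E X U = cut E X X + cut E X (U - X)" by (rule r)
  show "cut E U U = cut E X X + 2 * cut E X (U - X) + cut E (U - X) (U - X)"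
    using l[of U] r[of X] r[of "U - X"] cut_commute[of E X "U - X"] by simp
qed

text \<open>A maximiser of the ratio is compared with its subsets: deleting one vertex gives the
  minimum degree, splitting into \<open>X\<close> and \<open>U - X\<close> gives expansion. The
  logarithm supplies the gain, since for a part with at most half of the pairs it drops by
  \<open>ln 2\<close>.\<close>

lemma expander_subgraph:
  assumes fin: "finite V" and loops: "\<And>x. {x} \<notin> E" and pos: "0 < cut E V V"
  obtains U where "U \<subseteq> V" "0 < cut E U U"
    "\<And>x. x \<in> U \<Longrightarrow> cut E V V / (2 * real (card V) * (1 + ln (cut E V V))) \<le> cut E {x} U"
    "\<And>X. X \<subseteq> U \<Longrightarrow> 2 * cut E X U \<le> cut E U U \<Longrightarrow>
       cut E X U \<le> (5 + 4 * ln (cut E U U)) * cut E X (U - X)"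
proof -
  define f where "f U = cut E U U / (card U * (1 + ln (cut E U U)))" for U
  define \<U> where "\<U> = {U. U \<subseteq> V \<and> 0 < cut E U U}"
  have "finite (f ` \<U>)" "f ` \<U> \<noteq> {}"
    using fin pos by (auto simp: \<U>_def)
  then have "Max (f ` \<U>) \<in> f ` \<U>" by (rule Max_in)
  then obtain U where U: "U \<in> \<U>" "f U = Max (f ` \<U>)" by auto
  have max: "f X \<le> f U" if "X \<in> \<U>" for X
    using U(2) \<open>finite (f ` \<U>)\<close> that by simp
  define e where "e = cut E U U"
  define r where "r = f U"
  have UV: "U \<subseteq> V" and e0: "0 < e" using U(1) by (auto simp: \<U>_def e_def)
  have finU: "finite U" using UV fin finite_subset by auto
  have e1: "1 \<le> e" using e0 cut_ge_1 by (auto simp: e_def)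
  have "U \<noteq> {}" using e0 by (auto simp: e_def cut_def)
  then have cU: "0 < card U" using finU by (simp add: card_gt_0_iff)
  have r: "e = r * card U * (1 + ln e)"
    using cU add_pos_nonneg[OF zero_less_one ln_ge_zero[OF e1]]
    by (simp add: r_def f_def e_def[symmetric])
  have r0: "0 < r" using cU e1 ln_ge_zero[OF e1] unfolding r_def f_def e_def[symmetric]
    by (intro divide_pos_pos mult_pos_pos add_pos_nonneg) auto
  \<comment> \<open>Maximality of \<open>U\<close> in linear form. The free upper bound
    \<open>m\<close> permits both \<open>m = e\<close> and \<open>m = e / 2\<close>, and sets
    without internal pairs are covered too.\<close>
  have bound: "cut E X X \<le> r * card X * (1 + ln m)"
    if X: "X \<subseteq> U" and m: "cut E X X \<le> m" "1 \<le> m" for X m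
  proof (cases "0 < cut E X X")
    case True
    then have "X \<in> \<U>" using X UV by (auto simp: \<U>_def)
    have c1: "1 \<le> cut E X X" using True cut_ge_1 by auto
    have "X \<noteq> {}" using True by (auto simp: cut_def)
    then have cX: "0 < card X" using finU X finite_subset card_gt_0_iff by blast
    have "0 < card X * (1 + ln (cut E X X))"
      using cX c1 by (intro mult_pos_pos add_pos_nonneg) auto
    with max[OF \<open>X \<in> \<U>\<close>] have "cut E X X \<le> r * (card X * (1 + ln (cut E X X)))"
      unfolding r_def[symmetric] by (simp add: f_def pos_divide_le_eq)
    also have "\<dots> \<le> r * (card X * (1 + ln m))"
      using r0 m c1 by (intro mult_left_mono) auto
    finally show ?thesis by (simp add: mult.assoc)
  next
    case False
    then have "cut E X X = 0" using cut_nonneg[of E X X] by linarith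
    then show ?thesis using r0 m by simp
  qed
  show thesis
  proof (rule that[OF UV])
    show "0 < cut E U U" using e0 by (simp add: e_def)
  next
    fix x assume x: "x \<in> U"
    define d where "d = cut E {x} U"
    have xx: "cut E {x} {x} = 0" using loops by (simp add: cut_def)
    \<comment> \<open>Deleting \<open>x\<close> loses its pairs in both orders, which is the source
      of the 2 in the degree bound.\<close>
    have split: "e = 2 * d + cut E (U - {x}) (U - {x})"
      using cut_split[OF finU, of "{x}" E] x xx by (simp add: d_def e_def)
    have "cut E (U - {x}) (U - {x}) \<le> r * card (U - {x}) * (1 + ln e)"
      using split e1 by (intro bound) (auto simp: d_def)
    also have "real (card (U - {x})) = card U - 1"
      using x finU cU by (simp add: card_Diff_singleton of_nat_diff)
    finally have "e - 2 * d \<le> r * (card U - 1) * (1 + ln e)" using split by simp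
    moreover have "r * (card U - 1) * (1 + ln e) = e - r * (1 + ln e)"
      using r cU by (simp add: algebra_simps of_nat_diff)
    ultimately have d: "r * (1 + ln e) \<le> 2 * d" by linarith
    have "f V \<le> r" using max pos by (auto simp: r_def \<U>_def)
    also have "r \<le> r * (1 + ln e)" using r0 e1 by simp
    finally have "f V / 2 \<le> d" using d by simp
    then show "cut E V V / (2 * real (card V) * (1 + ln (cut E V V))) \<le> cut E {x} U"
      by (simp add: f_def d_def algebra_simps)
  next
    fix X assume X: "X \<subseteq> U" and half: "2 * cut E X U \<le> cut E U U"
    define b where "b = cut E X (U - X)"
    note s = cut_split[OF finU X, of E, folded b_def]
    have b0: "0 \<le> b" by (simp add: b_def)
    have l2: "1 / 2 \<le> ln (2::real)"
    proof (subst ln_ge_iff)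
      show "exp (1 / 2) \<le> (2::real)"
        using exp_bound[of "1 / 2 :: real"] by (simp add: power2_eq_square)
    qed simp
    show "cut E X U \<le> (5 + 4 * ln (cut E U U)) * cut E X (U - X)"
    proof (cases "2 \<le> e")
      case True
      have "cut E X X \<le> r * card X * (1 + ln (e / 2))"
        using s half b0 X True by (intro bound) (auto simp: e_def)
      also have "\<dots> = r * card X * (1 + ln e - ln 2)" using e0 by (simp add: ln_div)
      finally have 1: "cut E X X \<le> r * card X * (1 + ln e - ln 2)" .
      have 2: "cut E (U - X) (U - X) \<le> r * card (U - X) * (1 + ln e)"
        using e1 by (intro bound) (auto simp: e_def s(2) b0)
      have "real (card (U - X)) = real (card U) - real (card X)"
        using X finU by (simp add: card_Diff_subset finite_subset of_nat_diff card_mono)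
      with 2 have "cut E (U - X) (U - X) \<le> e - r * card X * (1 + ln e)"
        using r by (simp add: algebra_simps)
      \<comment> \<open>Adding the bounds for \<open>X\<close> and \<open>U - X\<close> cancels
        \<open>r * card X * (1 + ln e)\<close>; the surplus \<open>ln 2\<close> can only be paid for
        by the pairs between the two parts.\<close>
      with 1 s(2) have b: "r * card X * ln 2 \<le> 2 * b"
        by (simp add: e_def[symmetric] algebra_simps)
      have nn: "0 \<le> r * card X" using r0 by simp
      have "r * card X * (1 / 2) \<le> r * card X * ln 2" using nn l2 by (intro mult_left_mono)
      with b have b': "r * card X \<le> 4 * b" by simp
      have "cut E X X \<le> r * card X * (1 + ln e)"
        using 1 nn l2 mult_left_mono[of "1 + ln e - ln 2" "1 + ln e" "r * card X"] by simp
      also have "\<dots> \<le> (4 * b) * (1 + ln e)" using b' e1 by (intro mult_right_mono) auto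
      finally have "cut E X U \<le> (4 * b) * (1 + ln e) + b" using s(1) by simp
      also have "\<dots> = (5 + 4 * ln e) * b" by (simp add: algebra_simps)
      finally show ?thesis by (simp add: e_def b_def)
    next
      case False
      \<comment> \<open>Here \<open>e < 2\<close>, so the degree sum of \<open>X\<close> is an
        integer below 1.\<close>
      have "cut E X U = 0"
      proof (rule ccontr)
        assume "cut E X U \<noteq> 0"
        then have "1 \<le> cut E X U" using cut_ge_1[of E X U] cut_nonneg[of E X U] by linarith
        with False half show False by (simp add: e_def)
      qed
      then show ?thesis using e1 b0 by (simp add: e_def[symmetric] b_def)
    qed
  qed
qed


section \<open>Random colour sets\<close>

text \<open>For \<open>Q \<subseteq> C\<close>, the probability that a random subset of
  \<open>C\<close>, keeping each colour independently with probability \<open>q\<close>, equals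
  \<open>Q\<close>. Sums over \<open>Pow C\<close> with this weight are expectations.\<close>

definition subset_weight :: "real \<Rightarrow> 'c set \<Rightarrow> 'c set \<Rightarrow> real" where
  "subset_weight q C Q = q ^ card Q * (1 - q) ^ card (C - Q)"

text \<open>Independence: the expectation of a product over the chosen colours factorises. The
  avoidance probability and the exponential moment below are both instances.\<close>

lemma sum_subset_weight_prod:
  assumes "finite C"
  shows "(\<Sum>Q\<in>Pow C. subset_weight q C Q * (\<Prod>c\<in>Q. g c)) = (\<Prod>c\<in>C. q * g c + (1 - q))"
proof -
  have "(\<Sum>Q\<in>Pow C. subset_weight q C Q * (\<Prod>c\<in>Q. g c)) =
      (\<Sum>Q\<in>Pow C. (\<Prod>c\<in>Q. q * g c) * (\<Prod>c\<in>C - Q. 1 - q))"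
    by (rule sum.cong) (auto simp: subset_weight_def prod.distrib)
  also have "\<dots> = (\<Prod>c\<in>C. q * g c + (1 - q))"
    using assms by (simp add: prod_add)
  finally show ?thesis .
qed

lemma sum_subset_weight: "finite C \<Longrightarrow> (\<Sum>Q\<in>Pow C. subset_weight q C Q) = 1"
  using sum_subset_weight_prod[of C q "\<lambda>_. 1"] by simp

lemma prod_if_subset:
  fixes a b :: "'b :: comm_monoid_mult"
  assumes "finite C" "R \<subseteq> C"
  shows "(\<Prod>c\<in>C. if c \<in> R then a else b) = a ^ card R * b ^ card (C - R)"
proof -
  have "{c \<in> C. c \<in> R} = R" "{c \<in> C. c \<notin> R} = C - R" using assms by auto
  then show ?thesis using assms by (simp add: prod.If_cases Int_def)
qed

lemma sum_subset_weight_avoid: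
  assumes "finite C" "R \<subseteq> C"
  shows "(\<Sum>Q\<in>Pow C. subset_weight q C Q * of_bool (Q \<inter> R = {})) = (1 - q) ^ card R"
proof -
  have "of_bool (Q \<inter> R = {}) = (\<Prod>c\<in>Q. of_bool (c \<notin> R) :: real)" if "Q \<subseteq> C" for Q
  proof (cases "Q \<inter> R = {}")
    case True
    then have "(\<Prod>c\<in>Q. of_bool (c \<notin> R) :: real) = (\<Prod>c\<in>Q. 1)"
      by (intro prod.cong) auto
    then show ?thesis using True by simp
  next
    case False
    moreover have "finite Q" using that assms(1) finite_subset by auto
    ultimately show ?thesis by auto
  qed
  then have "(\<Sum>Q\<in>Pow C. subset_weight q C Q * of_bool (Q \<inter> R = {})) =
      (\<Sum>Q\<in>Pow C. subset_weight q C Q * (\<Prod>c\<in>Q. of_bool (c \<notin> R)))"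
    by (intro sum.cong) auto
  also have "\<dots> = (\<Prod>c\<in>C. q * of_bool (c \<notin> R) + (1 - q))"
    using assms(1) by (rule sum_subset_weight_prod)
  also have "\<dots> = (\<Prod>c\<in>C. if c \<in> R then 1 - q else 1)"
    by (rule prod.cong) auto
  also have "\<dots> = (1 - q) ^ card R" by (simp add: prod_if_subset assms)
  finally show ?thesis .
qed

text \<open>Each colour of \<open>R\<close> contributes the factor
  \<open>1 + q * (exp 1 - 1)\<close>, at most \<open>1 + 2 * q \<le> exp (2 * q)\<close> because
  \<open>exp 1 \<le> 3\<close>.\<close>

lemma sum_subset_weight_exp_card:
  assumes "finite C" "R \<subseteq> C" "0 \<le> q"
  shows "(\<Sum>Q\<in>Pow C. subset_weight q C Q * exp (real (card (Q \<inter> R)))) \<le> exp (2 * q * card R)"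
proof -
  have "exp (real (card (Q \<inter> R))) = (\<Prod>c\<in>Q. if c \<in> R then exp 1 else 1 :: real)"
    if "Q \<subseteq> C" for Q
    using that assms(1) finite_subset[of Q C]
    by (simp add: prod.If_cases exp_of_nat_mult[symmetric])
  then have "(\<Sum>Q\<in>Pow C. subset_weight q C Q * exp (real (card (Q \<inter> R)))) =
      (\<Sum>Q\<in>Pow C. subset_weight q C Q * (\<Prod>c\<in>Q. if c \<in> R then exp 1 else 1))"
    by (intro sum.cong) auto
  also have "\<dots> = (\<Prod>c\<in>C. q * (if c \<in> R then exp 1 else 1) + (1 - q))"
    using assms(1) by (rule sum_subset_weight_prod)
  also have "\<dots> = (\<Prod>c\<in>C. if c \<in> R then q * exp 1 + (1 - q) else 1)"
    by (rule prod.cong) auto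
  also have "\<dots> = (q * exp 1 + (1 - q)) ^ card R" by (simp add: prod_if_subset assms)
  also have "\<dots> \<le> exp (2 * q) ^ card R"
  proof (rule power_mono)
    have "q * exp 1 \<le> q * 3" using exp_le assms(3) by (rule mult_left_mono)
    then show "q * exp 1 + (1 - q) \<le> exp (2 * q)"
      using exp_ge_add_one_self[of "2 * q"] by linarith
    have "q * 1 \<le> q * exp 1" using assms(3) by (intro mult_left_mono) auto
    then show "0 \<le> q * exp 1 + (1 - q)" by simp
  qed
  also have "\<dots> = exp (2 * q * card R)" by (simp add: exp_of_nat_mult[symmetric] mult_ac)
  finally show ?thesis .
qed

text \<open>The first-moment method for a random subset containing each colour independently with
  probability \<open>q\<close>; the last assumption makes the Chernoff bounds for all \<open>R x\<close> negligible.\<close>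

lemma exists_sparse_hitting_subset:
  fixes D :: "'w \<Rightarrow> real" and G :: "'w \<Rightarrow> 'c set" and R :: "'x \<Rightarrow> 'c set" and q m :: real
  assumes fin: "finite C" "finite W" "finite I" and q: "0 \<le> q" "q \<le> 1"
    and R: "\<And>x. x \<in> I \<Longrightarrow> R x \<subseteq> C" and G: "\<And>w. w \<in> W \<Longrightarrow> G w \<subseteq> C"
    and D: "\<And>w. w \<in> W \<Longrightarrow> 0 \<le> D w"
    and m: "0 < m"
      "m + sum D W * (\<Sum>x\<in>I. exp (- q * card (R x))) \<le> (\<Sum>w\<in>W. D w * (1 - exp (- q * card (G w))))"
  obtains Q where "Q \<subseteq> C" "\<And>x. x \<in> I \<Longrightarrow> card (Q \<inter> R x) \<le> 3 * q * card (R x)"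
    "m \<le> (\<Sum>w | w \<in> W \<and> Q \<inter> G w \<noteq> {}. D w)"
proof -
  let ?p = "subset_weight q C"
  define M where "M = sum D W"
  have M0: "0 \<le> M" using D by (simp add: M_def sum_nonneg)
  \<comment> \<open>\<open>Z Q\<close> is the weight hit by \<open>Q\<close>. In \<open>Y Q\<close>,
    every \<open>x\<close> whose bound \<open>3 * q * card (R x)\<close> is exceeded contributes
    more than 1, so the penalty \<open>M * Y Q\<close> outweighs any possible gain.\<close>
  define Z where "Z Q = (\<Sum>w\<in>W. D w * (1 - of_bool (Q \<inter> G w = {})))" for Q
  define Y where "Y Q = (\<Sum>x\<in>I. exp (- 3 * q * card (R x)) * exp (card (Q \<inter> R x)))" for Q
  have p0: "0 \<le> ?p Q" for Q using q by (simp add: subset_weight_def)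
  have "(\<Sum>w\<in>W. D w * (1 - exp (- q * card (G w)))) \<le> (\<Sum>w\<in>W. D w * (1 - (1 - q) ^ card (G w)))"
  proof (intro sum_mono mult_left_mono D diff_left_mono)
    fix w
    have "(1 - q) ^ card (G w) \<le> exp (- q) ^ card (G w)"
      using exp_ge_add_one_self[of "- q"] q by (intro power_mono) auto
    also have "\<dots> = exp (- q * card (G w))" by (simp add: exp_of_nat_mult[symmetric] mult_ac)
    finally show "(1 - q) ^ card (G w) \<le> exp (- q * card (G w))" .
  qed
  also have "\<dots> = (\<Sum>w\<in>W. \<Sum>Q\<in>Pow C. ?p Q * (D w * (1 - of_bool (Q \<inter> G w = {}))))"
  proof (rule sum.cong[OF refl])
    fix w assume w: "w \<in> W"
    have "(\<Sum>Q\<in>Pow C. ?p Q * (D w * (1 - of_bool (Q \<inter> G w = {})))) =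
        D w * ((\<Sum>Q\<in>Pow C. ?p Q) - (\<Sum>Q\<in>Pow C. ?p Q * of_bool (Q \<inter> G w = {})))"
      unfolding sum_subtractf[symmetric] sum_distrib_left by (rule sum.cong) (auto simp: algebra_simps)
    then show "D w * (1 - (1 - q) ^ card (G w)) =
        (\<Sum>Q\<in>Pow C. ?p Q * (D w * (1 - of_bool (Q \<inter> G w = {}))))"
      using sum_subset_weight[OF fin(1), of q] sum_subset_weight_avoid[OF fin(1) G[OF w], of q] by simp
  qed
  also have "\<dots> = (\<Sum>Q\<in>Pow C. ?p Q * Z Q)"
    unfolding Z_def sum_distrib_left by (rule sum.swap)
  finally have EZ: "(\<Sum>w\<in>W. D w * (1 - exp (- q * card (G w)))) \<le> (\<Sum>Q\<in>Pow C. ?p Q * Z Q)" .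
  have "(\<Sum>Q\<in>Pow C. ?p Q * Y Q) =
      (\<Sum>x\<in>I. exp (- 3 * q * card (R x)) * (\<Sum>Q\<in>Pow C. ?p Q * exp (card (Q \<inter> R x))))"
    unfolding Y_def sum_distrib_left by (subst sum.swap) (simp add: mult_ac)
  also have "\<dots> \<le> (\<Sum>x\<in>I. exp (- 3 * q * card (R x)) * exp (2 * q * card (R x)))"
    by (intro sum_mono mult_left_mono sum_subset_weight_exp_card fin R q) auto
  also have "\<dots> = (\<Sum>x\<in>I. exp (- q * card (R x)))"
    by (rule sum.cong) (auto simp: exp_add[symmetric])
  finally have EY: "(\<Sum>Q\<in>Pow C. ?p Q * Y Q) \<le> (\<Sum>x\<in>I. exp (- q * card (R x)))" .
  \<comment> \<open>Averaging: the expectation of \<open>Z Q - M * Y Q\<close> is at least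
    \<open>m\<close>, so some \<open>Q\<close> attains \<open>m\<close>.\<close>
  have "\<exists>Q\<in>Pow C. m \<le> Z Q - M * Y Q"
  proof (rule ccontr)
    assume "\<not> ?thesis"
    then have less: "Z Q - M * Y Q < m" if "Q \<in> Pow C" for Q
      using that by (simp only: bex_simps not_le)
    have "(\<Sum>Q\<in>Pow C. ?p Q * (Z Q - M * Y Q)) < (\<Sum>Q\<in>Pow C. ?p Q * m)"
    proof (rule sum_strict_mono_ex1)
      show "finite (Pow C)" using fin by simp
      show "\<forall>Q\<in>Pow C. ?p Q * (Z Q - M * Y Q) \<le> ?p Q * m"
      proof
        fix Q assume "Q \<in> Pow C"
        then show "?p Q * (Z Q - M * Y Q) \<le> ?p Q * m"
          by (rule mult_left_mono[OF less_imp_le[OF less] p0])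
      qed
      have "\<exists>Q\<in>Pow C. ?p Q \<noteq> 0"
      proof (rule ccontr)
        assume "\<not> ?thesis"
        then have "(\<Sum>Q\<in>Pow C. ?p Q) = 0" by (intro sum.neutral) blast
        then show False using sum_subset_weight[OF fin(1), of q] by simp
      qed
      then obtain Q where Q: "Q \<in> Pow C" "?p Q \<noteq> 0" ..
      then have "0 < ?p Q" using p0[of Q] by linarith
      with less[OF Q(1)] have "?p Q * (Z Q - M * Y Q) < ?p Q * m"
        by (rule mult_strict_left_mono)
      with Q(1) show "\<exists>Q\<in>Pow C. ?p Q * (Z Q - M * Y Q) < ?p Q * m" ..
    qed
    also have "\<dots> = m" using sum_subset_weight[OF fin(1), of q]
      by (simp add: sum_distrib_right[symmetric])
    finally have "(\<Sum>Q\<in>Pow C. ?p Q * Z Q) - M * (\<Sum>Q\<in>Pow C. ?p Q * Y Q) < m"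
      by (simp add: algebra_simps sum_subtractf sum_distrib_left)
    moreover have "M * (\<Sum>Q\<in>Pow C. ?p Q * Y Q) \<le> M * (\<Sum>x\<in>I. exp (- q * card (R x)))"
      using EY M0 by (rule mult_left_mono)
    ultimately show False using EZ m(2) by (simp add: M_def)
  qed
  then obtain Q where Q: "Q \<subseteq> C" "m \<le> Z Q - M * Y Q" by auto
  have Z: "Z Q = (\<Sum>w | w \<in> W \<and> Q \<inter> G w \<noteq> {}. D w)"
    unfolding Z_def sum.inter_filter[OF fin(2)] by (rule sum.cong) auto
  have "Z Q \<le> M" unfolding Z M_def using fin(2) D by (intro sum_mono2) auto
  have Y0: "0 \<le> Y Q" by (simp add: Y_def sum_nonneg)
  show thesis
  proof (rule that[OF Q(1)])
    show "m \<le> (\<Sum>w | w \<in> W \<and> Q \<inter> G w \<noteq> {}. D w)"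
      using Q(2) M0 Y0 Z mult_nonneg_nonneg[of M "Y Q"] by linarith
    fix x assume x: "x \<in> I"
    show "card (Q \<inter> R x) \<le> 3 * q * card (R x)"
    proof (rule ccontr)
      assume "\<not> ?thesis"
      then have "1 \<le> exp (- 3 * q * card (R x)) * exp (card (Q \<inter> R x))"
        by (simp add: exp_add[symmetric])
      also have "\<dots> \<le> Y Q" unfolding Y_def by (rule member_le_sum[OF x]) (use fin in auto)
      \<comment> \<open>Then \<open>M * Y Q \<ge> M \<ge> Z Q\<close>, so
        \<open>Z Q - M * Y Q \<le> 0 < m\<close>, a contradiction.\<close>
      finally have "M * 1 \<le> M * Y Q" using M0 by (intro mult_left_mono)
      then show False using Q(2) m(1) \<open>Z Q \<le> M\<close> by linarith
    qed
  qed
qed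


section \<open>Rainbow paths\<close>

lemma path_edges_Nil [simp]: "path_edges [] = {}"
  and path_edges_singleton [simp]: "path_edges [x] = {}"
  by (auto simp: path_edges_def)

lemma path_edges_Cons [simp]: "path_edges (x # y # p) = insert {x, y} (path_edges (y # p))"
proof -
  have "{i. Suc i < length (x # y # p)} = insert 0 (Suc ` {i. Suc i < length (y # p)})"
    by (auto simp: image_iff less_Suc_eq_0_disj)
  then have "(\<lambda>i. {(x # y # p) ! i, (x # y # p) ! Suc i}) ` {i. Suc i < length (x # y # p)} =
      insert {x, y} ((\<lambda>i. {(y # p) ! i, (y # p) ! Suc i}) ` {i. Suc i < length (y # p)})"
    by (simp add: image_image)
  then show ?thesis by (simp add: path_edges_def setcompr_eq_image)
qed

lemma path_edges_append: "path_edges (p @ x # q) = path_edges (p @ [x]) \<union> path_edges (x # q)"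
proof (induction p)
  case (Cons y p)
  then show ?case by (cases p) auto
qed auto

lemma path_edges_rev: "path_edges (rev p) = path_edges p"
proof (induction p rule: induct_list012)
  case (3 x y p)
  then show ?case by (simp add: path_edges_append[of "rev p" y "[x]"] insert_commute)
qed auto

lemma path_edges_subset_set: "e \<in> path_edges p \<Longrightarrow> e \<subseteq> set p"
  by (auto simp: path_edges_def)

lemma card_path_edges_le: "card (path_edges p) \<le> length p"
proof -
  have "path_edges p \<subseteq> (\<lambda>i. {p ! i, p ! Suc i}) ` {..<length p}"
    by (auto simp: path_edges_def)
  then have "card (path_edges p) \<le> card ((\<lambda>i. {p ! i, p ! Suc i}) ` {..<length p})"
    by (intro card_mono) auto
  also have "\<dots> \<le> length p" using card_image_le[of "{..<length p}"] by simp
  finally show ?thesis .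
qed

lemma finite_path_edges [simp]: "finite (path_edges p)"
proof -
  have "path_edges p \<subseteq> (\<lambda>i. {p ! i, p ! Suc i}) ` {..<length p}"
    by (auto simp: path_edges_def)
  then show ?thesis by (rule finite_subset) auto
qed

text \<open>Switch from \<open>p\<close> to the reversal of \<open>q\<close> at the first vertex of \<open>p\<close> that lies on \<open>q\<close>.\<close>

lemma join_paths:
  assumes "distinct p" "distinct q" "p \<noteq> []" "q \<noteq> []" "last p = last q"
  obtains r where "distinct r" "r \<noteq> []" "hd r = hd p" "last r = hd q"
    "set r \<subseteq> set p \<union> set q" "path_edges r \<subseteq> path_edges p \<union> path_edges q"
    "length r < length p + length q"
proof -
  have "\<exists>x\<in>set p. x \<in> set q" using assms(3-5) last_in_set by metis
  then obtain p1 x p2 where p: "p = p1 @ x # p2" "x \<in> set q" "\<forall>y\<in>set p1. y \<notin> set q"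
    using split_list_first_prop[of p "\<lambda>y. y \<in> set q"] by blast
  obtain q1 q2 where q: "q = q1 @ x # q2" using split_list p(2) by metis
  define r where "r = p1 @ x # rev q1"
  have "path_edges (x # rev q1) = path_edges (q1 @ [x])"
    using path_edges_rev[of "q1 @ [x]"] by simp
  then have "path_edges r = path_edges (p1 @ [x]) \<union> path_edges (q1 @ [x])"
    unfolding r_def by (subst path_edges_append) simp
  then have "path_edges r \<subseteq> path_edges p \<union> path_edges q"
    unfolding p(1) q path_edges_append[of p1 x p2] path_edges_append[of q1 x q2] by blast
  moreover have "distinct r" using assms(1,2) p q by (auto simp: r_def)
  moreover have "hd r = hd p" by (cases p1) (auto simp: r_def p)
  moreover have "last r = hd q" by (cases q1) (auto simp: r_def q)
  ultimately show thesis using p q by (intro that[of r]) (auto simp: r_def)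
qed

text \<open>\<open>Q\<close> and \<open>B\<close> are upper bounds for the colours and vertices, not
  the exact sets. Thus reserved sets and complements of forbidden sets are handled alike, and the
  predicate is monotone in both.\<close>

definition rainbow_path ::
  "'a set set \<Rightarrow> ('a set \<Rightarrow> 'c) \<Rightarrow> 'c set \<Rightarrow> 'a set \<Rightarrow> 'a \<Rightarrow> 'a \<Rightarrow> 'a list \<Rightarrow> bool" where
  "rainbow_path E \<chi> Q B u v p \<longleftrightarrow>
     is_path p \<and> hd p = u \<and> last p = v \<and> set p \<subseteq> B \<and>
     path_edges p \<subseteq> E \<and> rainbow \<chi> (path_edges p) \<and> \<chi> ` path_edges p \<subseteq> Q"

lemma rainbow_path_mono:
  "rainbow_path E \<chi> Q B u v p \<Longrightarrow> Q \<subseteq> Q' \<Longrightarrow> B \<subseteq> B' \<Longrightarrow> rainbow_path E \<chi> Q' B' u v p"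
  by (auto simp: rainbow_path_def)

lemma rainbow_path_trivial: "u \<in> B \<Longrightarrow> rainbow_path E \<chi> Q B u u [u]"
  by (simp add: rainbow_path_def is_path_def rainbow_def)

lemma rainbow_path_extend:
  assumes p: "rainbow_path E \<chi> Q B u x p" and w: "w \<notin> B" "{x, w} \<in> E" "\<chi> {x, w} \<notin> Q"
  shows "rainbow_path E \<chi> (insert (\<chi> {x, w}) Q) (insert w B) u w (p @ [w])"
proof -
  have ne: "p \<noteq> []" and x: "last p = x" using p by (auto simp: rainbow_path_def is_path_def)
  then have "p @ [w] = butlast p @ x # [w]" "butlast p @ [x] = p"
    using append_butlast_last_id by force+
  then have e: "path_edges (p @ [w]) = insert {x, w} (path_edges p)"
    using path_edges_append[of "butlast p" x "[w]"] by (simp only:) simp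
  have inj: "inj_on \<chi> (insert {x, w} (path_edges p))"
    using p w(3) by (auto simp: rainbow_path_def rainbow_def inj_on_insert)
  have "\<chi> ` path_edges p \<subseteq> Q" "path_edges p \<subseteq> E" "set p \<subseteq> B" "distinct p" "hd p = u"
    using p by (auto simp: rainbow_path_def is_path_def)
  then show ?thesis
    using w ne inj unfolding rainbow_path_def is_path_def rainbow_def e by auto
qed

text \<open>The paths may cross before \<open>w\<close>, so they are spliced by
  \<open>join_paths\<close>; disjoint colour sets make even the union of the two edge sets
  rainbow.\<close>

lemma rainbow_path_join:
  assumes p: "rainbow_path E \<chi> Q B u w p" and q: "rainbow_path E \<chi> Q' B' v w q"
    and Q: "Q \<inter> Q' = {}"
  obtains r where "rainbow_path E \<chi> (Q \<union> Q') (B \<union> B') u v r" "length r < length p + length q"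
proof -
  note pq = p[unfolded rainbow_path_def is_path_def rainbow_def]
    q[unfolded rainbow_path_def is_path_def rainbow_def]
  obtain r where r: "distinct r" "r \<noteq> []" "hd r = u" "last r = v"
      "set r \<subseteq> set p \<union> set q" "path_edges r \<subseteq> path_edges p \<union> path_edges q"
      "length r < length p + length q"
    using join_paths[of p q] pq by metis
  have "inj_on \<chi> (path_edges p \<union> path_edges q)"
    using pq Q unfolding inj_on_Un by blast
  then have "inj_on \<chi> (path_edges r)" using r(6) by (rule inj_on_subset)
  moreover have "\<chi> ` path_edges r \<subseteq> Q \<union> Q'" "path_edges r \<subseteq> E" "set r \<subseteq> B \<union> B'"
  proof -
    have "\<chi> ` path_edges p \<subseteq> Q" "\<chi> ` path_edges q \<subseteq> Q'" using pq by simp_all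
    then show "\<chi> ` path_edges r \<subseteq> Q \<union> Q'" using r(6) by blast
    have "path_edges p \<subseteq> E" "path_edges q \<subseteq> E" using pq by simp_all
    then show "path_edges r \<subseteq> E" using r(6) by blast
    have "set p \<subseteq> B" "set q \<subseteq> B'" using pq by simp_all
    then show "set r \<subseteq> B \<union> B'" using r(5) by blast
  qed
  ultimately have "rainbow_path E \<chi> (Q \<union> Q') (B \<union> B') u v r"
    using r(1-4) by (simp add: rainbow_path_def is_path_def rainbow_def)
  then show thesis using r(7) by (rule that)
qed


section \<open>Connecting vertices in expanders\<close>

text \<open>\<open>\<delta>\<close> is the expansion rate in degree sums, \<open>d\<close> a lower
  bound for the degrees in \<open>U\<close>, and \<open>q\<close> the probability that a colour is
  released in one round. By \<open>1 \<le> q * d\<close> every vertex expects at least one released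
  colour; \<open>tail\<close> is a union bound over \<open>U\<close> for the Chernoff failures,
  weighted by the total degree sum.\<close>

locale rainbow_expander =
  fixes U :: "'a set" and E :: "'a set set" and \<chi> :: "'a set \<Rightarrow> 'c" and \<delta> q d :: real
  assumes fin: "finite U" and loops: "{x} \<notin> E"
    and proper: "proper_edge_colouring E \<chi>"
    and expansion: "X \<subseteq> U \<Longrightarrow> 2 * cut E X U \<le> cut E U U \<Longrightarrow> \<delta> * cut E X U \<le> cut E X (U - X)"
    and min_degree: "x \<in> U \<Longrightarrow> d \<le> cut E {x} U"
    and delta: "0 < \<delta>" and q: "0 < q" "q \<le> 1" and d: "1 \<le> d" "1 \<le> q * d"
    and tail: "cut E U U * card U * exp (- q * d) \<le> \<delta> / 8"
begin

text \<open>Properness puts the colours at \<open>x\<close> in bijection with its neighbours in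
  \<open>U\<close>, so a share of the colours is the same share of the degree.\<close>

definition colours_at :: "'a \<Rightarrow> 'c set" where
  "colours_at x = (\<lambda>y. \<chi> {x, y}) ` {y \<in> U. {x, y} \<in> E}"

lemma inj_on_colour: "inj_on (\<lambda>y. \<chi> {x, y}) {y. {x, y} \<in> E}"
proof (rule inj_onI)
  fix y z assume yz: "y \<in> {y. {x, y} \<in> E}" "z \<in> {y. {x, y} \<in> E}" "\<chi> {x, y} = \<chi> {x, z}"
  then have "{x, y} = {x, z}"
    using proper[unfolded proper_edge_colouring_def, rule_format, of "{x, y}" "{x, z}"] by auto
  then show "y = z" by (auto simp: doubleton_eq_iff)
qed

lemma finite_colours_at [simp]: "finite (colours_at x)"
  using fin by (simp add: colours_at_def)

lemma card_colours_at: "real (card (colours_at x)) = cut E {x} U"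
  unfolding colours_at_def cut_singleton[OF fin]
  by (subst card_image) (auto intro: inj_on_subset[OF inj_on_colour])

lemma card_Int_colours_at:
  "real (card (T \<inter> colours_at x)) = cut {e \<in> E. \<chi> e \<in> T} {x} U"
proof -
  have "T \<inter> colours_at x = (\<lambda>y. \<chi> {x, y}) ` {y \<in> U. {x, y} \<in> {e \<in> E. \<chi> e \<in> T}}"
    by (auto simp: colours_at_def)
  then show ?thesis unfolding cut_singleton[OF fin]
    by (simp add: card_image inj_on_subset[OF inj_on_colour] subset_iff)
qed

lemma mass_ge: "X \<subseteq> U \<Longrightarrow> card X * d \<le> cut E X U"
  unfolding cut_eq_sum[of E X] using min_degree
  by (intro sum_bounded_below[where A = X and K = d, simplified]) auto

text \<open>With \<open>b\<close> the degree sum of \<open>B\<close>, expansion provides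
  \<open>\<delta> * b\<close> pairs leaving \<open>B\<close>. Each of \<open>S\<close> and
  \<open>T\<close> spoils at most \<open>\<delta> / 4 * b\<close>. The random release captures at
  least half of the remaining \<open>\<delta> / 2 * b\<close> in expected degree, and the tail costs
  at most \<open>\<delta> / 8 * b\<close>, leaving a gain of
  \<open>\<delta> / 8 * b\<close>.\<close>

lemma grow:
  assumes B: "B \<subseteq> U" "B \<noteq> {}" "2 * cut E B U \<le> cut E U U"
    and S: "finite S" "card S \<le> \<delta> / 4 * d"
    and T: "\<And>x. x \<in> U \<Longrightarrow> card (T \<inter> colours_at x) \<le> \<delta> / 4 * cut E {x} U"
  shows "\<exists>Q. Q \<inter> T = {} \<and> (\<forall>x\<in>U. card (Q \<inter> colours_at x) \<le> 3 * q * cut E {x} U) \<and>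
    (1 + \<delta> / 8) * cut E B U \<le> cut E (B \<union> {w \<in> U - B - S. \<exists>x\<in>B. {x, w} \<in> E \<and> \<chi> {x, w} \<in> Q}) U"
proof -
  define W where "W = U - B - S"
  define E' where "E' = {e \<in> E. \<chi> e \<notin> T}"
  define E'' where "E'' = {e \<in> E. \<chi> e \<in> T}"
  define G where "G w = (\<lambda>x. \<chi> {w, x}) ` {x \<in> B. {w, x} \<in> E'}" for w
  define C where "C = (\<Union>x\<in>U. colours_at x)"
  define b where "b = cut E B U"
  have finB: "finite B" and finW: "finite W" and WU: "W \<subseteq> U"
    using B fin finite_subset by (auto simp: W_def)
  have "1 \<le> card B" using finB B(2) by (simp add: Suc_leI card_gt_0_iff)
  then have "1 * 1 \<le> card B * d" using d by (intro mult_mono) auto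
  then have b1: "1 \<le> b" using mass_ge[OF B(1)] by (simp add: b_def)
  have cG: "real (card (G w)) = cut E' {w} B" for w
    unfolding G_def cut_singleton[OF finB]
    by (subst card_image) (auto simp: E'_def intro: inj_on_subset[OF inj_on_colour])
  have split: "cut E X Y = cut E' X Y + cut E'' X Y" for X Y
    unfolding cut_def E'_def E''_def sum.distrib[symmetric] by (intro sum.cong) auto
  have "\<delta> * b \<le> cut E B (U - B)" using expansion[OF B(1,3)] by (simp add: b_def)
  also have "\<dots> \<le> cut E B (W \<union> S)"
    using S finW by (intro cut_mono_right) (auto simp: W_def)
  also have "\<dots> = cut E B W + cut E B S"
    using cut_Un_left[of W S E B] S finW by (simp add: cut_commute[of E B] W_def Diff_Int_distrib2 inf_commute)
  \<comment> \<open>Each vertex of \<open>B\<close> has at most \<open>card S\<close> neighbours in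
    \<open>S\<close>, while it contributes at least \<open>d\<close> to \<open>b\<close>.\<close>
  also have "cut E B S \<le> card B * (\<delta> / 4 * d)"
    by (rule order_trans[OF cut_le_card mult_left_mono[OF S(2)]]) simp
  also have "\<dots> \<le> \<delta> / 4 * b"
    using mult_left_mono[OF mass_ge[OF B(1)], of "\<delta> / 4"] delta by (simp add: b_def mult_ac)
  also have "cut E B W = cut E' B W + cut E'' B W" by (rule split)
  also have "cut E'' B W \<le> cut E'' B U" using fin WU by (rule cut_mono_right)
  also have "\<dots> \<le> (\<Sum>x\<in>B. \<delta> / 4 * cut E {x} U)"
    unfolding cut_eq_sum[of E'' B] unfolding E''_def card_Int_colours_at[symmetric]
    using B(1) T by (intro sum_mono) auto
  also have "\<dots> = \<delta> / 4 * b" by (simp add: b_def cut_eq_sum[of E B] sum_distrib_left)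
  finally have good: "\<delta> / 2 * b \<le> cut E' W B" by (simp add: cut_commute)
  have err: "(\<Sum>w\<in>W. cut E {w} U) * (\<Sum>x\<in>U. exp (- q * card (colours_at x))) \<le> \<delta> / 8 * b"
  proof -
    have "(\<Sum>x\<in>U. exp (- q * card (colours_at x))) \<le> (\<Sum>x\<in>U. exp (- q * d))"
      using q min_degree by (intro sum_mono) (simp add: card_colours_at)
    moreover have "(\<Sum>w\<in>W. cut E {w} U) \<le> cut E U U"
      using cut_mono_left[OF fin WU, of E U] by (simp add: cut_eq_sum[of E W])
    ultimately have "(\<Sum>w\<in>W. cut E {w} U) * (\<Sum>x\<in>U. exp (- q * card (colours_at x))) \<le>
        cut E U U * (\<Sum>x\<in>U. exp (- q * d))"
      by (intro mult_mono) (auto intro: sum_nonneg)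
    also have "\<dots> \<le> \<delta> / 8 * 1" using tail by simp
    also have "\<dots> \<le> \<delta> / 8 * b" using b1 delta by (intro mult_left_mono) auto
    finally show ?thesis .
  qed
  \<comment> \<open>Edges into \<open>w\<close> have distinct colours, so \<open>w\<close> is hit with probability at least
    \<open>min 1 (q |G w|) / 2\<close>; multiplied by its degree, which is at least \<open>1 / q\<close> and at least
    \<open>|G w|\<close>, this is at least half the number of usable edges into \<open>w\<close>.\<close>
  have hit: "cut E' {w} B / 2 \<le> cut E {w} U * (1 - exp (- q * card (G w)))" if w: "w \<in> W" for w
  proof -
    define g D where "g = cut E' {w} B" and "D = cut E {w} U"
    have g0: "0 \<le> g" by (simp add: g_def)
    have "g \<le> cut E {w} B" using split[of "{w}" B] cut_nonneg[of E'' "{w}" B] by (simp add: g_def)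
    also have "\<dots> \<le> D" unfolding D_def using fin B(1) by (rule cut_mono_right)
    finally have "q * g \<le> q * D" using q by simp
    moreover have "d \<le> D" unfolding D_def using w WU by (intro min_degree) blast
    then have "1 \<le> q * D" using d(2) mult_left_mono[of d D q] q by linarith
    \<comment> \<open>Both 1 and \<open>q * g\<close> are at most \<open>q * D\<close>, hence
      \<open>1 + q * g \<le> 2 * (q * D)\<close>. The inequality
      \<open>1 - exp (- y) \<ge> y / (1 + y)\<close> then finishes the estimate.\<close>
    ultimately have "g * (1 + q * g) \<le> g * (2 * (q * D))" using g0 by (intro mult_left_mono) auto
    then have "g / 2 \<le> D * (q * g / (1 + q * g))"
      using g0 q by (simp add: field_simps add_pos_nonneg)
    also have "\<dots> \<le> D * (1 - exp (- q * g))"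
    proof (rule mult_left_mono)
      have pos: "0 < 1 + q * g" using g0 q by (simp add: add_pos_nonneg)
      have "exp (- q * g) = inverse (exp (q * g))" by (simp add: exp_minus)
      also have "\<dots> \<le> inverse (1 + q * g)"
        using exp_ge_add_one_self[of "q * g"] pos by (intro le_imp_inverse_le)
      finally show "q * g / (1 + q * g) \<le> 1 - exp (- q * g)"
        using pos by (simp add: field_simps)
    qed (simp add: D_def)
    finally show ?thesis by (simp add: g_def D_def cG)
  qed
  have "\<delta> / 8 * b + (\<Sum>w\<in>W. cut E {w} U) * (\<Sum>x\<in>U. exp (- q * card (colours_at x))) \<le>
      (\<Sum>w\<in>W. cut E' {w} B / 2)"
    using err good by (simp add: cut_eq_sum[of E' W] sum_divide_distrib[symmetric])
  also have "\<dots> \<le> (\<Sum>w\<in>W. cut E {w} U * (1 - exp (- q * card (G w))))"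
    by (intro sum_mono hit)
  finally have main: "\<delta> / 8 * b +
      (\<Sum>w\<in>W. cut E {w} U) * (\<Sum>x\<in>U. exp (- q * card (colours_at x))) \<le>
      (\<Sum>w\<in>W. cut E {w} U * (1 - exp (- q * card (G w))))" .
  have RC: "colours_at x \<subseteq> C" if "x \<in> U" for x using that by (auto simp: C_def)
  have GC: "G w \<subseteq> C" if "w \<in> W" for w
  proof -
    have "G w \<subseteq> colours_at w" using B(1) by (auto simp: G_def E'_def colours_at_def)
    then show ?thesis using that WU by (auto simp: C_def)
  qed
  obtain Q where Q: "Q \<subseteq> C" "\<And>x. x \<in> U \<Longrightarrow> card (Q \<inter> colours_at x) \<le> 3 * q * card (colours_at x)"
      "\<delta> / 8 * b \<le> (\<Sum>w | w \<in> W \<and> Q \<inter> G w \<noteq> {}. cut E {w} U)"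
  proof (rule exists_sparse_hitting_subset)
    show "finite C" using fin by (simp add: C_def)
    show "0 < \<delta> / 8 * b" using b1 delta by simp
    show "0 \<le> q" "q \<le> 1" using q by simp_all
  qed (rule finW fin RC GC main cut_nonneg | assumption | rule that; assumption)+
  \<comment> \<open>Removing \<open>T\<close> from \<open>Q\<close> loses nothing: the sets
    \<open>G w\<close> contain only colours outside \<open>T\<close>.\<close>
  define N where "N = {w \<in> U - B - S. \<exists>x\<in>B. {x, w} \<in> E \<and> \<chi> {x, w} \<in> Q - T}"
  have "{w. w \<in> W \<and> Q \<inter> G w \<noteq> {}} = N"
    by (auto simp: N_def W_def G_def E'_def insert_commute)
  with Q(3) have "\<delta> / 8 * b \<le> cut E N U" by (simp add: cut_eq_sum[of E N])
  moreover have "cut E (B \<union> N) U = b + cut E N U"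
    unfolding b_def using finB fin by (intro cut_Un_left) (auto simp: N_def)
  ultimately have "(1 + \<delta> / 8) * cut E B U \<le> cut E (B \<union> N) U"
    by (simp add: b_def algebra_simps)
  moreover have "card ((Q - T) \<inter> colours_at x) \<le> 3 * q * cut E {x} U" if "x \<in> U" for x
  proof -
    have "card ((Q - T) \<inter> colours_at x) \<le> card (Q \<inter> colours_at x)" by (intro card_mono) auto
    then show ?thesis using Q(2)[OF that] by (simp add: card_colours_at)
  qed
  ultimately show ?thesis
    unfolding N_def by (intro exI[of _ "Q - T"]) blast
qed

end


section \<open>Iterated growth and the connection of two vertices\<close>

context rainbow_expander
begin

text \<open>Iterates \<open>grow\<close>. Colours of earlier rounds join the forbidden ones, at most
  a share \<open>3 * q\<close> of every degree per round, and assumption \<open>k\<close> keeps the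
  total within the \<open>\<delta> / 4\<close> that \<open>grow\<close> tolerates. The parameter
  \<open>\<tau>\<close> lets a second search treat the colours of a first one as forbidden.\<close>

lemma reach:
  fixes k :: nat
  assumes u: "u \<in> U - S" and S: "finite S" "card S \<le> \<delta> / 4 * d"
    and T: "\<And>x. x \<in> U \<Longrightarrow> card (T \<inter> colours_at x) \<le> \<tau> * cut E {x} U"
    and k: "\<tau> + 3 * q * k \<le> \<delta> / 4"
  shows "\<exists>B Q. u \<in> B \<and> B \<subseteq> U - S \<and> Q \<inter> T = {} \<and>
    (\<forall>x\<in>U. card (Q \<inter> colours_at x) \<le> 3 * q * k * cut E {x} U) \<and>
    (cut E U U < 2 * cut E B U \<or> (1 + \<delta> / 8) ^ k * d \<le> cut E B U) \<and>
    (\<forall>w\<in>B. \<exists>p. rainbow_path E \<chi> Q B u w p \<and> length p \<le> Suc k)"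
  using k
proof (induction k)
  case 0
  have "d \<le> cut E {u} U" using u by (intro min_degree) simp
  then show ?case
    using u rainbow_path_trivial[of u "{u}" E \<chi> "{}"] by (intro exI[of _ "{u}"] exI[of _ "{}"]) auto
next
  case (Suc k)
  have "3 * q * real k \<le> 3 * q * real (Suc k)" using q by simp
  with Suc.prems have k: "\<tau> + 3 * q * k \<le> \<delta> / 4" by linarith
  from Suc.IH[OF k] obtain B Q where B: "u \<in> B" "B \<subseteq> U - S" and QT: "Q \<inter> T = {}"
    and Q: "\<And>x. x \<in> U \<Longrightarrow> card (Q \<inter> colours_at x) \<le> 3 * q * k * cut E {x} U"
    and mass: "cut E U U < 2 * cut E B U \<or> (1 + \<delta> / 8) ^ k * d \<le> cut E B U"
    and paths: "\<And>w. w \<in> B \<Longrightarrow> \<exists>p. rainbow_path E \<chi> Q B u w p \<and> length p \<le> Suc k"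
    by metis
  show ?case
  proof (cases "cut E U U < 2 * cut E B U")
    \<comment> \<open>More than half of the degree sum is already reached, beyond the range of
      \<open>expansion\<close>; \<open>B\<close> and \<open>Q\<close> are kept.\<close>
    case True
    have "card (Q \<inter> colours_at x) \<le> 3 * q * real (Suc k) * cut E {x} U" if "x \<in> U" for x
      using Q[OF that] mult_right_mono[OF \<open>3 * q * k \<le> 3 * q * Suc k\<close> cut_nonneg[of E "{x}" U]]
      by (rule order_trans)
    moreover have "\<exists>p. rainbow_path E \<chi> Q B u w p \<and> length p \<le> Suc (Suc k)" if "w \<in> B" for w
      using paths[OF that] le_SucI by blast
    ultimately show ?thesis using B QT True by blast
  next
    case False
    have TQ: "card ((T \<union> Q) \<inter> colours_at x) \<le> \<delta> / 4 * cut E {x} U" if x: "x \<in> U" for x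
    proof -
      have "card ((T \<union> Q) \<inter> colours_at x) \<le> card (T \<inter> colours_at x) + card (Q \<inter> colours_at x)"
        unfolding Int_Un_distrib2 by (rule card_Un_le)
      then have "card ((T \<union> Q) \<inter> colours_at x) \<le> (\<tau> + 3 * q * k) * cut E {x} U"
        using T[OF x] Q[OF x] by (simp add: distrib_right)
      also have "\<dots> \<le> \<delta> / 4 * cut E {x} U" using k by (intro mult_right_mono) auto
      finally show ?thesis .
    qed
    have BU: "B \<subseteq> U" "B \<noteq> {}" "2 * cut E B U \<le> cut E U U" using B False by auto
    obtain Q' where Q': "Q' \<inter> (T \<union> Q) = {}"
        "\<forall>x\<in>U. card (Q' \<inter> colours_at x) \<le> 3 * q * cut E {x} U"
        "(1 + \<delta> / 8) * cut E B U \<le> cut E (B \<union> {w \<in> U - B - S. \<exists>x\<in>B. {x, w} \<in> E \<and> \<chi> {x, w} \<in> Q'}) U"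
      using grow[OF BU S TQ] by blast
    define N where "N = {w \<in> U - B - S. \<exists>x\<in>B. {x, w} \<in> E \<and> \<chi> {x, w} \<in> Q'}"
    have cols: "card ((Q \<union> Q') \<inter> colours_at x) \<le> 3 * q * real (Suc k) * cut E {x} U" if x: "x \<in> U" for x
    proof -
      have "card ((Q \<union> Q') \<inter> colours_at x) \<le> card (Q \<inter> colours_at x) + card (Q' \<inter> colours_at x)"
        unfolding Int_Un_distrib2 by (rule card_Un_le)
      then show ?thesis using Q[OF x] bspec[OF Q'(2) x] by (simp add: algebra_simps)
    qed
    have mass': "(1 + \<delta> / 8) ^ Suc k * d \<le> cut E (B \<union> N) U"
    proof -
      have "(1 + \<delta> / 8) * ((1 + \<delta> / 8) ^ k * d) \<le> (1 + \<delta> / 8) * cut E B U"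
        using mass False delta by (intro mult_left_mono) auto
      then show ?thesis using Q'(3) by (simp add: N_def mult.assoc)
    qed
    have paths': "\<exists>p. rainbow_path E \<chi> (Q \<union> Q') (B \<union> N) u w p \<and> length p \<le> Suc (Suc k)"
      if w: "w \<in> B \<union> N" for w
    proof (cases "w \<in> B")
      case True
      then obtain p where "rainbow_path E \<chi> Q B u w p" "length p \<le> Suc k" using paths by blast
      then show ?thesis using rainbow_path_mono[of E \<chi> Q B u w p "Q \<union> Q'" "B \<union> N"] le_SucI by blast
    next
      case False
      with w obtain x where x: "x \<in> B" "{x, w} \<in> E" "\<chi> {x, w} \<in> Q'" by (auto simp: N_def)
      then obtain p where p: "rainbow_path E \<chi> Q B u x p" "length p \<le> Suc k" using paths by blast
      have "\<chi> {x, w} \<notin> Q" using x(3) Q'(1) by blast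
      from rainbow_path_extend[OF p(1) False x(2) this]
      have "rainbow_path E \<chi> (Q \<union> Q') (B \<union> N) u w (p @ [w])"
        by (rule rainbow_path_mono) (use x w False in auto)
      then show ?thesis using p(2) by (intro exI[of _ "p @ [w]"]) simp
    qed
    have sub: "B \<union> N \<subseteq> U - S" "u \<in> B \<union> N" "(Q \<union> Q') \<inter> T = {}"
      using B QT Q'(1) by (auto simp: N_def)
    show ?thesis
      by (intro exI[of _ "B \<union> N"] exI[of _ "Q \<union> Q'"] conjI ballI disjI2 sub cols mass' paths')
  qed
qed

text \<open>Two searches, the second avoiding the colours of the first, each gather more than half
  of the degree sum, so their vertex sets meet. The colour shares are \<open>\<delta> / 8\<close>
  for \<open>T\<close> and at most \<open>\<delta> / 16\<close> per search, together
  \<open>\<delta> / 4\<close>.\<close>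

lemma connect:
  fixes k :: nat
  assumes u: "u \<in> U - S" and v: "v \<in> U - S" and S: "finite S" "card S \<le> \<delta> / 4 * d"
    and T: "finite T" "card T \<le> \<delta> / 8 * d" and k: "48 * q * k \<le> \<delta>"
    and large: "cut E U U \<le> (1 + \<delta> / 8) ^ k * d"
  obtains p where "rainbow_path E \<chi> (- T) (U - S) u v p" "length p \<le> 2 * k + 1"
proof -
  have pos: "0 < cut E U U"
  proof -
    have "d \<le> cut E {u} U" using u by (intro min_degree) simp
    also have "\<dots> \<le> cut E U U" using u fin by (intro cut_mono_left) auto
    finally show ?thesis using d by simp
  qed
  \<comment> \<open>By \<open>large\<close>, the second alternative means that the whole degree sum
    is reached, which exceeds half of it because it is positive.\<close>
  have half: "cut E U U < 2 * cut E B U"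
    if "cut E U U < 2 * cut E B U \<or> (1 + \<delta> / 8) ^ k * d \<le> cut E B U" for B
    using that large pos by linarith
  have T': "card (T \<inter> colours_at x) \<le> \<delta> / 8 * cut E {x} U" if x: "x \<in> U" for x
  proof -
    have "card (T \<inter> colours_at x) \<le> card T" using T(1) by (intro card_mono) auto
    moreover have "\<delta> / 8 * d \<le> \<delta> / 8 * cut E {x} U"
      using min_degree[OF x] delta by (intro mult_left_mono) auto
    ultimately show ?thesis using T(2) by linarith
  qed
  have "\<delta> / 8 + 3 * q * k \<le> \<delta> / 4" using k delta by simp
  from reach[OF u S T' this] obtain B Q where B: "B \<subseteq> U - S" "Q \<inter> T = {}"
      "\<And>x. x \<in> U \<Longrightarrow> card (Q \<inter> colours_at x) \<le> 3 * q * k * cut E {x} U"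
      "cut E U U < 2 * cut E B U"
      "\<And>w. w \<in> B \<Longrightarrow> \<exists>p. rainbow_path E \<chi> Q B u w p \<and> length p \<le> Suc k"
    using half by metis
  have TQ: "card ((T \<union> Q) \<inter> colours_at x) \<le> (\<delta> / 8 + 3 * q * k) * cut E {x} U" if x: "x \<in> U" for x
  proof -
    have "card ((T \<union> Q) \<inter> colours_at x) \<le> card (T \<inter> colours_at x) + card (Q \<inter> colours_at x)"
      unfolding Int_Un_distrib2 by (rule card_Un_le)
    then show ?thesis using T'[OF x] B(3)[OF x] by (simp add: distrib_right)
  qed
  have "\<delta> / 8 + 3 * q * k + 3 * q * k \<le> \<delta> / 4" using k by simp
  from reach[OF v S TQ this] obtain B' Q' where B': "B' \<subseteq> U - S" "Q' \<inter> (T \<union> Q) = {}"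
      "cut E U U < 2 * cut E B' U"
      "\<And>w. w \<in> B' \<Longrightarrow> \<exists>p. rainbow_path E \<chi> Q' B' v w p \<and> length p \<le> Suc k"
    using half by metis
  have "B \<inter> B' \<noteq> {}"
  proof
    assume disj: "B \<inter> B' = {}"
    have "finite B" "finite B'" using B B' fin by (auto intro: finite_subset[OF _ fin])
    then have "cut E B U + cut E B' U = cut E (B \<union> B') U" using disj by (simp add: cut_Un_left)
    also have "\<dots> \<le> cut E U U" using B(1) B'(1) fin by (intro cut_mono_left) auto
    finally show False using B(4) B'(3) by simp
  qed
  then obtain w where "w \<in> B" "w \<in> B'" by blast
  then obtain p p' where p: "rainbow_path E \<chi> Q B u w p" "length p \<le> Suc k"
    "rainbow_path E \<chi> Q' B' v w p'" "length p' \<le> Suc k"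
    using B(5) B'(4) by blast
  have "Q \<inter> Q' = {}" using B'(2) by blast
  from rainbow_path_join[OF p(1,3) this]
  obtain r where r: "rainbow_path E \<chi> (Q \<union> Q') (B \<union> B') u v r" "length r < length p + length p'" .
  show thesis
  proof (rule that)
    show "rainbow_path E \<chi> (- T) (U - S) u v r"
      by (rule rainbow_path_mono[OF r(1)]) (use B(1,2) B'(1,2) in blast)+
    \<comment> \<open>Each list has at most \<open>k + 1\<close> vertices, and the joined one is
      strictly shorter than both together.\<close>
    show "length r \<le> 2 * k + 1" using r(2) p(2,4) by simp
  qed
qed

end


section \<open>Rainbow subdivisions\<close>

lemma path_interior_subset: "path_interior p \<subseteq> set p"
  by (cases p) (auto simp: path_interior_def dest: in_set_butlastD)

lemma path_interior_ends:
  assumes "distinct p"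
  shows "hd p \<notin> path_interior p" "last p \<notin> path_interior p"
proof -
  show "hd p \<notin> path_interior p"
    using assms by (cases p) (auto simp: path_interior_def dest: in_set_butlastD)
  show "last p \<notin> path_interior p"
  proof (cases "tl p = []")
    case False
    then have "tl p = butlast (tl p) @ [last p]" by (metis append_butlast_last_id last_tl)
    moreover have "distinct (tl p)" using assms by (rule distinct_tl)
    ultimately have "distinct (butlast (tl p) @ [last p])" by argo
    then show ?thesis by (simp add: path_interior_def)
  qed (simp add: path_interior_def)
qed

text \<open>Greedy choice, one edge at a time. The next path must avoid all branch vertices and all
  vertices of earlier paths, except its own two ends, and all colours already used; as
  \<open>l\<close> bounds the vertices of each path, both forbidden sets have size at most
  \<open>s\<close>.\<close>

lemma embed_rainbow_paths:
  fixes b :: "'w \<Rightarrow> 'a" and l s :: nat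
  assumes conn: "\<And>u v S T. u \<in> U - S \<Longrightarrow> v \<in> U - S \<Longrightarrow> finite S \<Longrightarrow> card S \<le> s \<Longrightarrow>
      finite T \<Longrightarrow> card T \<le> s \<Longrightarrow> \<exists>p. rainbow_path E \<chi> (- T) (U - S) u v p \<and> length p \<le> l"
    and W: "finite W" and b: "b ` W \<subseteq> U"
  shows "finite F \<Longrightarrow> F \<subseteq> complete_edges W \<Longrightarrow> card W + card F * l \<le> s \<Longrightarrow>
    \<exists>P. (\<forall>e\<in>F. is_path (P e) \<and> {hd (P e), last (P e)} = b ` e \<and> path_interior (P e) \<inter> b ` W = {} \<and>
          set (P e) \<subseteq> U \<and> path_edges (P e) \<subseteq> E \<and> length (P e) \<le> l) \<and>
      disjoint_family_on (\<lambda>e. path_interior (P e)) F \<and> rainbow \<chi> (\<Union>e\<in>F. path_edges (P e))"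
proof (induction F rule: finite_induct)
  case empty
  show ?case by (simp add: disjoint_family_on_def rainbow_def)
next
  case (insert e F)
  have "F \<subseteq> complete_edges W" "card W + card F * l \<le> s"
    using insert.prems insert.hyps by auto
  from insert.IH[OF this] obtain P where P0: "\<forall>f\<in>F. is_path (P f) \<and> {hd (P f), last (P f)} = b ` f \<and>
        path_interior (P f) \<inter> b ` W = {} \<and> set (P f) \<subseteq> U \<and> path_edges (P f) \<subseteq> E \<and> length (P f) \<le> l"
      and disj: "disjoint_family_on (\<lambda>e. path_interior (P e)) F"
      and rb: "rainbow \<chi> (\<Union>e\<in>F. path_edges (P e))"
    by blast
  note P = bspec[OF P0]
  obtain i j where e: "e = {i, j}" "i \<in> W" "j \<in> W"
    using insert.prems(1) by (auto simp: complete_edges_def card_2_iff)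
  define Z where "Z = b ` W \<union> (\<Union>f\<in>F. set (P f))"
  define S where "S = Z - {b i, b j}"
  define T where "T = \<chi> ` (\<Union>f\<in>F. path_edges (P f))"
  have finZ: "finite Z" using W insert.hyps by (simp add: Z_def)
  have "card (\<Union>f\<in>F. set (P f)) \<le> (\<Sum>f\<in>F. card (set (P f)))"
    using insert.hyps by (intro card_UN_le)
  also have "\<dots> \<le> (\<Sum>f\<in>F. l)"
    using P by (intro sum_mono) (meson card_length order_trans)
  finally have "card (\<Union>f\<in>F. set (P f)) \<le> card F * l" by simp
  then have "card Z \<le> card W + card F * l"
    unfolding Z_def using card_Un_le[of "b ` W"] card_image_le[OF W, of b] by (meson add_mono order_trans)
  moreover have "card S \<le> card Z" unfolding S_def using finZ by (intro card_mono) auto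
  ultimately have cS: "card S \<le> s" using insert.prems(2) insert.hyps by simp
  have "card T \<le> card (\<Union>f\<in>F. path_edges (P f))"
    unfolding T_def using insert.hyps by (intro card_image_le) simp
  also have "\<dots> \<le> (\<Sum>f\<in>F. card (path_edges (P f)))"
    using insert.hyps by (intro card_UN_le)
  also have "\<dots> \<le> (\<Sum>f\<in>F. l)"
    using P by (intro sum_mono) (meson card_path_edges_le order_trans)
  finally have cT: "card T \<le> s" using insert.prems(2) insert.hyps by simp
  have "b i \<in> U - S" "b j \<in> U - S" using e b by (auto simp: S_def)
  moreover have "finite S" "finite T" using finZ insert.hyps by (simp_all add: S_def T_def)
  ultimately obtain p where p: "rainbow_path E \<chi> (- T) (U - S) (b i) (b j) p" "length p \<le> l"
    using conn cS cT by blast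
  note p' = p(1)[unfolded rainbow_path_def is_path_def]
  have "distinct p" "hd p = b i" "last p = b j" using p' by auto
  then have "path_interior p \<subseteq> set p - {b i, b j}"
    using path_interior_subset[of p] path_interior_ends[of p] by auto
  also have "\<dots> \<subseteq> - Z" using p' by (auto simp: S_def)
  finally have int: "path_interior p \<inter> Z = {}" by blast
  define P' where "P' = P(e := p)"
  have P'_F: "P' f = P f" if "f \<in> F" for f using that insert.hyps by (auto simp: P'_def)
  have P'_e: "P' e = p" by (simp add: P'_def)
  have "\<forall>f\<in>insert e F. is_path (P' f) \<and> {hd (P' f), last (P' f)} = b ` f \<and>
      path_interior (P' f) \<inter> b ` W = {} \<and> set (P' f) \<subseteq> U \<and> path_edges (P' f) \<subseteq> E \<and> length (P' f) \<le> l"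
  proof -
    have "path_interior p \<inter> b ` W = {}" using int by (auto simp: Z_def)
    moreover have "set p \<subseteq> U" using p' by blast
    moreover have "is_path p" "{hd p, last p} = b ` e" "path_edges p \<subseteq> E"
      using p' e by (simp_all add: is_path_def)
    ultimately show ?thesis using P p(2) by (simp add: P'_e P'_F)
  qed
  moreover have "disjoint_family_on (\<lambda>f. path_interior (P' f)) (insert e F)"
  proof -
    have "path_interior p \<inter> (\<Union>f\<in>F. path_interior (P f)) = {}"
      using int path_interior_subset by (fastforce simp: Z_def)
    moreover have "disjoint_family_on (\<lambda>f. path_interior (P' f)) F"
      using disj by (simp add: disjoint_family_on_def P'_F)
    ultimately show ?thesis using insert.hyps
      by (simp add: disjoint_family_on_insert P'_e P'_F Int_commute)
  qed
  moreover have "rainbow \<chi> (\<Union>f\<in>insert e F. path_edges (P' f))"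
  proof -
    have "\<chi> ` path_edges p \<inter> T = {}" "inj_on \<chi> (path_edges p)"
      using p' by (auto simp: rainbow_def)
    then have "inj_on \<chi> (path_edges p \<union> (\<Union>f\<in>F. path_edges (P f)))"
      using rb unfolding inj_on_Un T_def rainbow_def by blast
    then show ?thesis by (simp add: rainbow_def P'_e P'_F)
  qed
  ultimately show ?case by blast
qed


section \<open>Edge counts and the choice of parameters\<close>

lemma complete_edges_image: "complete_edges W \<subseteq> (\<lambda>(x, y). {x, y}) ` (W \<times> W)"
  by (auto simp: complete_edges_def card_2_iff image_iff)

lemma card_complete_edges_le:
  assumes "finite W"
  shows "finite (complete_edges W)" "card (complete_edges W) \<le> card W ^ 2"
proof -
  have fin: "finite (W \<times> W)" using assms by simp
  show "finite (complete_edges W)"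
    using complete_edges_image finite_subset fin by blast
  have "card (complete_edges W) \<le> card ((\<lambda>(x, y). {x, y}) ` (W \<times> W))"
    using fin by (intro card_mono complete_edges_image) simp
  also have "\<dots> \<le> card (W \<times> W)" using fin by (rule card_image_le)
  finally show "card (complete_edges W) \<le> card W ^ 2"
    by (simp add: card_cartesian_product power2_eq_square)
qed

lemma card_edges_le_cut:
  assumes "simple_graph V E"
  shows "real (card E) \<le> cut E V V"
proof -
  have finV: "finite V" using assms by (simp add: simple_graph_def)
  define A where "A = (SIGMA x:V. {y \<in> V. {x, y} \<in> E})"
  have fin: "finite A" using finV by (simp add: A_def)
  have "E \<subseteq> (\<lambda>(x, y). {x, y}) ` A"
  proof
    fix e assume e: "e \<in> E"
    then obtain x y where "e = {x, y}" "x \<in> V" "y \<in> V"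
      using assms by (auto simp: simple_graph_def card_2_iff)
    with e show "e \<in> (\<lambda>(x, y). {x, y}) ` A" by (auto simp: A_def image_iff)
  qed
  then have "card E \<le> card A" using fin surj_card_le by blast
  also have "real (card A) = cut E V V"
    using finV by (simp add: A_def card_SigmaI cut_eq_sum[of E V] cut_singleton)
  finally show ?thesis by simp
qed

text \<open>Passing to the expander costs a factor of order \<open>L\<close>, leaving minimum degree
  \<open>d\<close> of order \<open>t^2 * L^4\<close>. With \<open>\<delta>\<close> of order
  \<open>1 / L\<close>, about \<open>L / \<delta>\<close> rounds suffice, so \<open>k\<close> is of
  order \<open>L^2\<close>. Sharing \<open>\<delta>\<close> among them makes \<open>q\<close> of
  order \<open>1 / L^3\<close>, and \<open>q * d\<close>, at least of order \<open>L\<close>, beats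
  the tail.\<close>

lemma rainbow_subdivision_of_dense:
  fixes t n :: nat and V :: "'a set" and \<chi> :: "'a set \<Rightarrow> 'c"
  defines "L \<equiv> ln (real n)"
  assumes t: "t \<ge> 2" and G: "simple_graph V E" "card V = n" "proper_edge_colouring E \<chi>"
    and L: "144 \<le> L" and dense: "5000000 * real t ^ 2 * L ^ 5 * n \<le> card E"
  shows "\<exists>V' E' (b :: nat \<Rightarrow> 'a) P. subgraph V' E' V E \<and> rainbow \<chi> E' \<and>
    subdivision_via {..<t} (complete_edges {..<t}) b P V' E' \<and>
    (\<forall>e \<in> complete_edges {..<t}. real (path_length (P e)) \<le> 1300 * L\<^sup>2)"
proof -
  define F where "F = complete_edges {..<t}"
  define d where "d = 1000000 * real t ^ 2 * L ^ 4"
  \<comment> \<open>From \<open>5 + 4 * ln e \<le> 5 + 8 * L \<le> 9 * L\<close>, where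
    \<open>e \<le> n^2\<close> counts the pairs in the expander.\<close>
  define \<delta> where "\<delta> = 1 / (9 * L)"
  \<comment> \<open>Each round gains at least a factor \<open>exp (\<delta> / 16)\<close>, so
    \<open>288 * L^2\<close> rounds would reach \<open>exp (2 * L)\<close>; 300 leaves
    slack.\<close>
  define k where "k = nat \<lceil>300 * L\<^sup>2\<rceil>"
  \<comment> \<open>Equality in the condition \<open>48 * q * k \<le> \<delta>\<close> of
    \<open>connect\<close>.\<close>
  define q where "q = \<delta> / (48 * k)"
  define s where "s = t + card F * (2 * k + 1)"
  have finV: "finite V" using G by (simp add: simple_graph_def)
  have n0: "0 < n" using L by (cases "n = 0") (auto simp: L_def)
  have nL: "exp L = n" using n0 by (simp add: L_def)
  have L1: "1 \<le> L" using L by simp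
  have t1: "1 \<le> real t ^ 2" using t by (simp add: one_le_power)
  have L4: "1 \<le> L ^ 4" using L1 by (rule one_le_power)
  have L2: "1 \<le> L\<^sup>2" using L1 by (rule one_le_power)
  have d_ge: "1000000 * L ^ 4 \<le> d" using mult_right_mono[OF t1, of "L ^ 4"] L4 by (simp add: d_def)
  have d1: "1 \<le> d" using d_ge L4 by linarith
  have k: "300 * L\<^sup>2 \<le> k" "k \<le> 300 * L\<^sup>2 + 1"
    unfolding k_def using L2 by linarith+
  have k0: "0 < real k" using k(1) L2 by linarith
  have loops: "{x} \<notin> E" for x using G(1) by (force simp: simple_graph_def)
  have cutV: "card E \<le> cut E V V" using G(1) by (rule card_edges_le_cut)
  have "0 < 5000000 * real t ^ 2 * L ^ 5 * n" using t L1 n0 by (intro mult_pos_pos) auto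
  then have cut0: "0 < cut E V V" using dense cutV by linarith
  obtain U where U: "U \<subseteq> V" "0 < cut E U U"
    and deg: "\<And>x. x \<in> U \<Longrightarrow> cut E V V / (2 * real (card V) * (1 + ln (cut E V V))) \<le> cut E {x} U"
    and expand: "\<And>X. X \<subseteq> U \<Longrightarrow> 2 * cut E X U \<le> cut E U U \<Longrightarrow>
       cut E X U \<le> (5 + 4 * ln (cut E U U)) * cut E X (U - X)"
    by (rule expander_subgraph[of V E, OF finV loops cut0]) blast
  have finU: "finite U" using U(1) finV finite_subset by blast
  have cU: "real (card U) \<le> n" using card_mono[OF finV U(1)] G(2) by simp
  have cut_le: "cut E X X \<le> exp (2 * L)" if "X \<subseteq> V" for X
  proof -
    have "cut E X X \<le> card X * card X" by (metis cut_le_card of_nat_mult)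
    also have "\<dots> \<le> real n * real n"
      using card_mono[OF finV that] G(2) by (simp add: mult_mono)
    also have "\<dots> = exp (2 * L)" by (simp add: nL[symmetric] exp_add[symmetric])
    finally show ?thesis .
  qed
  have ln_le: "ln (cut E X X) \<le> 2 * L" if "X \<subseteq> V" "0 < cut E X X" for X
    using cut_le[OF that(1)] that(2) by (simp add: ln_le_cancel_iff[symmetric, of _ "exp (2 * L)"] del: ln_le_cancel_iff)
  have min_deg: "d \<le> cut E {x} U" if "x \<in> U" for x
  proof -
    have l0: "0 \<le> ln (cut E V V)" using cut_ge_1[OF cut0] by simp
    have "2 * real n * (1 + ln (cut E V V)) \<le> 2 * real n * (1 + 2 * L)"
      using ln_le[OF order_refl cut0] by (intro mult_left_mono) auto
    \<comment> \<open>\<open>5 / 2 * L\<close> absorbs \<open>1 + 2 * L\<close>; doubling it gives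
      the ratio 5 between the constants 5000000 of the density and 1000000 of
      \<open>d\<close>.\<close>
    also have "\<dots> \<le> 2 * real n * (5 / 2 * L)" using L by (intro mult_left_mono) auto
    finally have D: "2 * real n * (1 + ln (cut E V V)) \<le> 5 * n * L" by (simp add: mult_ac)
    have "d * (5 * n * L) = 5000000 * real t ^ 2 * L ^ 5 * n"
      by (simp add: d_def eval_nat_numeral)
    then have "d * (5 * n * L) \<le> cut E V V" using dense cutV by linarith
    moreover have "d * (2 * real n * (1 + ln (cut E V V))) \<le> d * (5 * n * L)"
      using D d1 by (intro mult_left_mono) auto
    ultimately have "d * (2 * real n * (1 + ln (cut E V V))) \<le> cut E V V" by linarith
    moreover have "0 < 2 * real n * (1 + ln (cut E V V))" using n0 l0 by (intro mult_pos_pos) auto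
    ultimately have "d \<le> cut E V V / (2 * real n * (1 + ln (cut E V V)))"
      by (simp only: pos_le_divide_eq)
    with deg[OF that] show ?thesis by (simp add: G(2))
  qed
  have delta0: "0 < \<delta>" using L1 by (simp add: \<delta>_def)
  have q0: "0 < q" using delta0 k0 by (simp add: q_def)
  have qd: "4 * L \<le> q * d"
  proof -
    \<comment> \<open>Here \<open>1 / q = 432 * L * k\<close>, and
      \<open>432 * k \<le> 432 * 301 * L^2\<close> is well below
      \<open>250000 * L^2\<close>.\<close>
    have "48 * 9 * real k \<le> 250000 * L\<^sup>2" using k(2) L2 by linarith
    then have "4 * L * (48 * 9 * L * k) \<le> 4 * L * (L * (250000 * L\<^sup>2))"
      using L1 by (intro mult_left_mono) (auto simp: mult_ac)
    also have "\<dots> = 1000000 * L ^ 4" by (simp add: eval_nat_numeral)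
    finally have "4 * L * (48 * 9 * L * k) \<le> d" using d_ge by linarith
    then show ?thesis using L1 k0 by (simp add: q_def \<delta>_def field_simps)
  qed
  interpret rainbow_expander U E \<chi> \<delta> q d
  proof
    fix X assume X: "X \<subseteq> U" "2 * cut E X U \<le> cut E U U"
    have "cut E X U \<le> (5 + 4 * ln (cut E U U)) * cut E X (U - X)" using X by (rule expand)
    also have "\<dots> \<le> (9 * L) * cut E X (U - X)"
      using ln_le[OF U] L by (intro mult_right_mono) auto
    finally show "\<delta> * cut E X U \<le> cut E X (U - X)"
      using L1 by (simp add: \<delta>_def field_simps)
  next
    have "\<delta> \<le> 1" "1 \<le> 48 * real k" using L1 k0 by (auto simp: \<delta>_def)
    then show "q \<le> 1" by (simp add: q_def divide_le_eq_1)
  next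
    \<comment> \<open>Pairs times vertices are at most \<open>exp (3 * L)\<close>, so
      \<open>q * d \<ge> 4 * L\<close> leaves \<open>exp (- L)\<close>, to be compared with
      \<open>\<delta> / 8 = 1 / (72 * L)\<close>. The assumption \<open>144 \<le> L\<close> enters
      at \<open>72 * L \<le> L^2 / 2\<close>.\<close>
    have "cut E U U * card U * exp (- q * d) \<le> exp (2 * L) * exp L * exp (- (4 * L))"
      using cut_le[OF U(1)] cU nL qd by (intro mult_mono) auto
    also have "\<dots> = inverse (exp L)" by (simp add: exp_add[symmetric] exp_minus[symmetric])
    also have "\<dots> \<le> inverse (72 * L)"
    proof (rule le_imp_inverse_le)
      have "72 * L \<le> L\<^sup>2 / 2" using L by (simp add: power2_eq_square)
      then show "72 * L \<le> exp L"
        using exp_lower_Taylor_quadratic[of L] L1 by linarith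
    qed (use L1 in simp)
    also have "\<dots> = \<delta> / 8" by (simp add: \<delta>_def field_simps)
    finally show "cut E U U * card U * exp (- q * d) \<le> \<delta> / 8" .
  qed (use finU loops G(3) min_deg delta0 q0 d1 qd L1 in auto)
  have large: "cut E U U \<le> (1 + \<delta> / 8) ^ k * d"
  proof -
    define x where "x = \<delta> / 8"
    have x: "0 \<le> x" "x \<le> 1" using L1 delta0 by (auto simp: x_def \<delta>_def)
    have "exp (x / 2) \<le> 1 + x / 2 + (x / 2)\<^sup>2" using x by (intro exp_bound) auto
    also have "(x / 2)\<^sup>2 \<le> x / 2"
      using x mult_left_mono[of x 1 x] by (simp add: power2_eq_square)
    finally have step: "exp (x / 2) \<le> 1 + x" by simp
    have "2 * L \<le> k * (x / 2)"
      using k(1) L1 L2 by (simp add: x_def \<delta>_def field_simps power2_eq_square)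
    then have "exp (2 * L) \<le> exp (x / 2) ^ k" by (simp add: exp_of_nat_mult[symmetric])
    also have "\<dots> \<le> (1 + x) ^ k" using step by (intro power_mono) auto
    also have "\<dots> \<le> (1 + x) ^ k * d" using x d1 mult_left_mono[of 1 d "(1 + x) ^ k"] by simp
    finally show ?thesis using cut_le[OF U(1)] by (simp add: x_def)
  qed
  have finF: "finite F" and cF: "card F \<le> t ^ 2"
    using card_complete_edges_le[of "{..<t}"] by (simp_all add: F_def)
  have s: "real s \<le> \<delta> / 8 * d"
  proof -
    have "real s \<le> real t ^ 2 + real t ^ 2 * (2 * k + 1)"
    proof -
      have "t \<le> t ^ 2" using t by (simp add: power2_eq_square)
      then have "s \<le> t ^ 2 + t ^ 2 * (2 * k + 1)"
        unfolding s_def using cF by (intro add_mono mult_le_mono1)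
      then show ?thesis by (metis (mono_tags) of_nat_le_iff of_nat_add of_nat_mult of_nat_power of_nat_numeral of_nat_1)
    qed
    also have "\<dots> = real t ^ 2 * (2 * k + 2)" by (simp add: algebra_simps)
    also have "\<dots> \<le> real t ^ 2 * (1000 * L\<^sup>2)"
      using k(2) L2 by (intro mult_left_mono) auto
    also have "\<dots> \<le> real t ^ 2 * (10000 * L ^ 3)"
    proof (rule mult_left_mono)
      have "L\<^sup>2 \<le> L ^ 3" using L1 by (intro power_increasing) auto
      then show "1000 * L\<^sup>2 \<le> 10000 * L ^ 3" using L2 by linarith
    qed simp
    \<comment> \<open>The right-hand side is \<open>1000000 / 72 * t^2 * L^3\<close>, and
      \<open>1000000 / 72 > 10000\<close>.\<close>
    also have "\<dots> \<le> \<delta> / 8 * d"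
      using L1 by (simp add: \<delta>_def d_def field_simps eval_nat_numeral)
    finally show ?thesis .
  qed
  have conn: "\<exists>p. rainbow_path E \<chi> (- T) (U - S) u v p \<and> length p \<le> 2 * k + 1"
    if "u \<in> U - S" "v \<in> U - S" "finite S" "card S \<le> s" "finite T" "card T \<le> s" for u v S T
  proof -
    have "real (card S) \<le> \<delta> / 8 * d" "real (card T) \<le> \<delta> / 8 * d"
      using that s by linarith+
    moreover have "\<delta> / 8 * d \<le> \<delta> / 4 * d" using delta0 d1 by simp
    moreover have "48 * q * k \<le> \<delta>" using k0 by (simp add: q_def)
    ultimately show ?thesis
      using connect[OF that(1-3) _ that(5) _ _ large] by force
  qed
  \<comment> \<open>Some vertex of \<open>U\<close> has at least \<open>d \<ge> t\<close> neighbours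
    in \<open>U\<close>, so there is room for the branch vertices.\<close>
  have "t \<le> card U"
  proof -
    have "t \<le> s" by (simp add: s_def)
    then have "real t \<le> \<delta> / 8 * d" using s by linarith
    also have "\<dots> \<le> 1 * d" using L1 d1 by (intro mult_right_mono) (auto simp: \<delta>_def)
    also obtain x where "x \<in> U" using U(2) by (force simp: cut_def)
    have "1 * d \<le> cut E {x} U" using min_deg \<open>x \<in> U\<close> by simp
    also have "\<dots> \<le> card U" using cut_le_card[of E "{x}" U] by simp
    finally show ?thesis by simp
  qed
  then obtain b where b: "inj_on b {..<t}" "b ` {..<t} \<subseteq> U"
    using card_le_inj[of "{..<t}" U] finU by auto
  have "\<exists>P. (\<forall>e\<in>F. is_path (P e) \<and> {hd (P e), last (P e)} = b ` e \<and> path_interior (P e) \<inter> b ` {..<t} = {} \<and>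
          set (P e) \<subseteq> U \<and> path_edges (P e) \<subseteq> E \<and> length (P e) \<le> 2 * k + 1) \<and>
      disjoint_family_on (\<lambda>e. path_interior (P e)) F \<and> rainbow \<chi> (\<Union>e\<in>F. path_edges (P e))"
    by (rule embed_rainbow_paths[where s = s and U = U])
      (use conn b(2) finF in \<open>auto simp: F_def s_def\<close>)
  then obtain P where P: "\<forall>e\<in>F. is_path (P e) \<and> {hd (P e), last (P e)} = b ` e \<and>
        path_interior (P e) \<inter> b ` {..<t} = {} \<and>
        set (P e) \<subseteq> U \<and> path_edges (P e) \<subseteq> E \<and> length (P e) \<le> 2 * k + 1"
      "disjoint_family_on (\<lambda>e. path_interior (P e)) F" "rainbow \<chi> (\<Union>e\<in>F. path_edges (P e))"
    by blast
  define V' where "V' = b ` {..<t} \<union> (\<Union>e\<in>F. set (P e))"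
  define E' where "E' = (\<Union>e\<in>F. path_edges (P e))"
  have "V' \<subseteq> V" using P(1) b(2) U(1) by (fastforce simp: V'_def)
  moreover have E'E: "E' \<subseteq> E" using P(1) by (auto simp: E'_def)
  moreover have "e \<subseteq> V'" if "e \<in> E'" for e
    using that path_edges_subset_set by (fastforce simp: E'_def V'_def)
  ultimately have "subgraph V' E' V E"
    using G(1) finite_subset[of V' V] by (auto simp: subgraph_def simple_graph_def)
  moreover have "rainbow \<chi> E'" using P(3) by (simp add: E'_def)
  moreover have "subdivision_via {..<t} F b P V' E'"
    unfolding subdivision_via_def using b(1) P(1,2) by (simp add: V'_def E'_def)
  moreover have "real (path_length (P e)) \<le> 1300 * L\<^sup>2" if "e \<in> F" for e
  proof -
    \<comment> \<open>At most \<open>2 * k + 1\<close> vertices, hence at most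
      \<open>2 * k \<le> 600 * L^2 + 2\<close> edges.\<close>
    have "path_length (P e) \<le> 2 * k" using P(1) that by (auto simp: path_length_def)
    then show ?thesis using k(2) L2 by linarith
  qed
  ultimately show ?thesis unfolding F_def by blast
qed

text \<open>The inequality \<open>y \<le> exp y\<close> at \<open>y = x / m\<close>, raised to the
  power \<open>m\<close>.\<close>

lemma exp_ge_power_div:
  fixes x :: real
  assumes "0 \<le> x" "0 < m"
  shows "(x / real m) ^ m \<le> exp x"
proof -
  have "(x / m) ^ m \<le> exp (x / m) ^ m"
    using assms exp_ge_add_one_self[of "x / m"] by (intro power_mono) (linarith, simp)
  also have "\<dots> = exp x" using assms by (simp add: exp_of_nat_mult[symmetric])
  finally show ?thesis .
qed

theorem theorem1p2:
  fixes t :: nat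
  assumes "t \<ge> 2"
  shows "\<exists>c::real. c > 0 \<and>
    (\<forall>n::nat. n \<ge> t \<longrightarrow>
      (\<forall>(V :: 'a set) (E :: 'a set set) (\<chi> :: 'a set \<Rightarrow> 'c).
        simple_graph V E \<and> card V = n \<and> proper_edge_colouring E \<chi> \<and>
        real (card E) \<ge> real n * exp (c * sqrt (ln (real n)))
        \<longrightarrow>
        (\<exists>V' E' (b :: nat \<Rightarrow> 'a) (P :: nat set \<Rightarrow> 'a list).
          subgraph V' E' V E \<and>
          rainbow \<chi> E' \<and>
          subdivision_via {..<t} (complete_edges {..<t}) b P V' E' \<and>
          (\<forall>e \<in> complete_edges {..<t}.
             real (path_length (P e)) \<le> 1300 * (ln (real n))\<^sup>2))))"
proof (intro exI[of _ "50000000 * real t ^ 2"] conjI allI impI)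
  \<comment> \<open>\<open>c / 10\<close> equals the coefficient \<open>5000000 * t^2\<close>
    demanded by \<open>rainbow_subdivision_of_dense\<close>, and \<open>c\<close> is large enough to
    force \<open>144 \<le> L\<close>.\<close>
  define c where "c = 50000000 * real t ^ 2"
  have t1: "1 \<le> real t ^ 2" using assms by (simp add: one_le_power)
  then have c: "50000000 \<le> c" by (simp add: c_def)
  then show "0 < 50000000 * real t ^ 2" unfolding c_def[symmetric] by simp
  fix n :: nat and V :: "'a set" and E :: "'a set set" and \<chi> :: "'a set \<Rightarrow> 'c"
  assume n: "t \<le> n"
  assume "simple_graph V E \<and> card V = n \<and> proper_edge_colouring E \<chi> \<and>
    real n * exp (50000000 * real t ^ 2 * sqrt (ln (real n))) \<le> real (card E)"
  then have G: "simple_graph V E" "card V = n" "proper_edge_colouring E \<chi>"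
    and dense: "real n * exp (c * sqrt (ln (real n))) \<le> card E"
    by (auto simp: c_def)
  define L where "L = ln (real n)"
  have n2: "2 \<le> n" using n assms by simp
  have L0: "0 < L" using n2 by (simp add: L_def)
  \<comment> \<open>There are at most \<open>n^2\<close> edges, so the density assumption itself
    excludes small \<open>n\<close>.\<close>
  have "c * sqrt L \<le> L"
  proof -
    have "real n * exp (c * sqrt L) \<le> real n * real n"
      using dense card_edges_le_cut[OF G(1)] cut_le_card[of E V V] G(2) by (simp add: L_def)
    then have "exp (c * sqrt L) \<le> exp L" using n2 by (simp add: L_def)
    then show ?thesis by simp
  qed
  then have "c * sqrt L \<le> sqrt L * sqrt L" using L0 by simp
  then have "c \<le> sqrt L" by (rule mult_right_le_imp_le) (use L0 in simp)
  then have "12 \<le> sqrt L" using c by linarith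
  then have "12 * 12 \<le> sqrt L * sqrt L" using L0 by (intro mult_mono) auto
  then have L: "144 \<le> L" using L0 by simp
  \<comment> \<open>The bound \<open>(x / 10)^10 \<le> exp x\<close> at \<open>x = c sqrt L\<close> gives exactly the power \<open>L^5\<close>.\<close>
  have "5000000 * real t ^ 2 * L ^ 5 \<le> (c / 10) ^ 10 * L ^ 5"
    using self_le_power[of "c / 10" 10] c L0 by (intro mult_right_mono) (auto simp: c_def)
  also have "\<dots> = (c * sqrt L / 10) ^ 10"
    using L0 power_mult[of "sqrt L" 2 5] by (simp add: power_mult_distrib power_divide)
  also have "\<dots> \<le> exp (c * sqrt L)"
    using exp_ge_power_div[of "c * sqrt L" 10] c L0 by simp
  finally have "5000000 * real t ^ 2 * L ^ 5 * n \<le> exp (c * sqrt L) * n"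
    by (intro mult_right_mono) auto
  also have "\<dots> \<le> card E" using dense by (simp add: L_def mult.commute)
  finally have "5000000 * real t ^ 2 * L ^ 5 * n \<le> card E" .
  from rainbow_subdivision_of_dense[OF assms G L[unfolded L_def] this[unfolded L_def]]
  show "\<exists>V' E' (b :: nat \<Rightarrow> 'a) (P :: nat set \<Rightarrow> 'a list). subgraph V' E' V E \<and> rainbow \<chi> E' \<and>
      subdivision_via {..<t} (complete_edges {..<t}) b P V' E' \<and>
      (\<forall>e \<in> complete_edges {..<t}. real (path_length (P e)) \<le> 1300 * (ln (real n))\<^sup>2)" .
qed

end
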